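(* Let $F$ be a finite bipartite graph with at least one edge and with no isolated vertices. Then the following are equivalent: (i) for every integer $n\ge 1$ there exists a connected spanning subgraph of $K_{n,n}$ that contains no subgraph isomorphic to $F$; (ii) $F$ is not isomorphic to any of the graphs $K_2,\ 2K_2,\ P_3,\ P_3\cup K_2,\ P_4$.
   Context: All graphs are finite and simple. $P_k$ is the path on $k$ vertices; $G\cup H$ is the vertex-disjoint union; $2K_2$ is the disjoint union of two edges. "Contains $F$" means contains a (not necessarily induced) subgraph isomorphic to $F$. A spanning subgraph of $K_{n,n}$ is a subgraph containing all $2n$ vertices. *)

theory Defs
  imports "Graph_Theory.Digraph_Isomorphism" "Graph_Theory.Kuratowski"
begin

text \<open>
  A finite simple graph is a \<^typ>\<open>'a pair_pre_digraph\<close> satisfying \<^const>\<open>pair_graph\<close>: the arc set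
  is a finite, symmetric and irreflexive relation on a finite vertex set, so that an undirected
  edge is represented by its two arcs.
\<close>

definition complete_graph :: "nat \<Rightarrow> nat pair_pre_digraph" where
  "complete_graph n = \<lparr> pverts = {..<n}, parcs = {(i, j). i < n \<and> j < n \<and> i \<noteq> j} \<rparr>"

definition complete_bipartite_graph :: "nat \<Rightarrow> nat \<Rightarrow> (nat + nat) pair_pre_digraph" where
  "complete_bipartite_graph m n =
    \<lparr> pverts = {..<m} <+> {..<n},
      parcs = (Inl ` {..<m}) \<times> (Inr ` {..<n}) \<union> (Inr ` {..<n}) \<times> (Inl ` {..<m}) \<rparr>"

definition path_graph :: "nat \<Rightarrow> nat pair_pre_digraph" where
  "path_graph k =
    \<lparr> pverts = {..<k}, parcs = {(i, j). i < k \<and> j < k \<and> (j = Suc i \<or> i = Suc j)} \<rparr>"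

definition disjoint_union ::
  "'a pair_pre_digraph \<Rightarrow> 'b pair_pre_digraph \<Rightarrow> ('a + 'b) pair_pre_digraph" where
  "disjoint_union G H =
    \<lparr> pverts = pverts G <+> pverts H,
      parcs = map_prod Inl Inl ` parcs G \<union> map_prod Inr Inr ` parcs H \<rparr>"

definition bipartite :: "'a pair_pre_digraph \<Rightarrow> bool" where
  "bipartite G \<longleftrightarrow>
    (\<exists>U V. pverts G = U \<union> V \<and> U \<inter> V = {} \<and> parcs G \<subseteq> U \<times> V \<union> V \<times> U)"

definition no_isolated_verts :: "'a pair_pre_digraph \<Rightarrow> bool" where
  "no_isolated_verts G \<longleftrightarrow> (\<forall>v \<in> pverts G. \<exists>w. (v, w) \<in> parcs G)"

definition graph_iso :: "'a pair_pre_digraph \<Rightarrow> 'b pair_pre_digraph \<Rightarrow> bool" where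
  "graph_iso G H \<longleftrightarrow> digraph_iso (with_proj G) (with_proj H)"

text \<open>
  \<^const>\<open>subgraph\<close> and \<^const>\<open>spanning\<close> also admit subdigraphs whose arc set is not symmetric; the
  conjunct \<^const>\<open>pair_graph\<close> restricts to undirected subgraphs.
\<close>

definition spanning_subgraph :: "'a pair_pre_digraph \<Rightarrow> 'a pair_pre_digraph \<Rightarrow> bool" where
  "spanning_subgraph H G \<longleftrightarrow> pair_graph H \<and> spanning (with_proj H) (with_proj G)"

definition contains_copy :: "'a pair_pre_digraph \<Rightarrow> 'b pair_pre_digraph \<Rightarrow> bool" where
  "contains_copy G F \<longleftrightarrow>
    (\<exists>H. pair_graph H \<and> subgraph (with_proj H) (with_proj G) \<and> graph_iso H F)"

lemma complete_graph_complete_digraph: "K\<^bsub>n\<^esub> (with_proj (complete_graph n))"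
  by (auto simp: complete_digraph_pair_def complete_graph_def)

lemma complete_bipartite_graph_complete_bipartite_digraph:
  "K\<^bsub>m,n\<^esub> (with_proj (complete_bipartite_graph m n))"
proof -
  let ?U = "Inl ` {..<m} :: (nat + nat) set" and ?V = "Inr ` {..<n} :: (nat + nat) set"
  have "?U \<inter> ?V = {}" "card ?U = m" "card ?V = n"
    by (auto simp: card_image)
  then show ?thesis
    unfolding complete_bipartite_digraph_pair_def complete_bipartite_graph_def Plus_def
    by (intro conjI exI[of _ ?U] exI[of _ ?V]) auto
qed

lemma pair_graph_path_graph: "pair_graph (path_graph k)"
proof -
  have "finite (parcs (path_graph k))"
    by (rule finite_subset[of _ "{..<k} \<times> {..<k}"]) (auto simp: path_graph_def)
  then show ?thesis
    by unfold_locales (auto simp: path_graph_def symmetric_def intro: symI)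
qed

lemma pair_graph_disjoint_union:
  assumes "pair_graph G" "pair_graph H"
  shows "pair_graph (disjoint_union G H)"
proof -
  interpret G: pair_graph G by fact
  interpret H: pair_graph H by fact
  have "sym (parcs G)" "sym (parcs H)"
    using G.sym_arcs H.sym_arcs by (auto simp: symmetric_def)
  then have "sym (parcs (disjoint_union G H))"
    by (fastforce simp: disjoint_union_def sym_def)
  then show ?thesis
    by unfold_locales
      (auto simp: disjoint_union_def symmetric_def G.wellformed' H.wellformed'
        dest: G.no_loops' H.no_loops')
qed

lemma graph_iso_iff_bij_betw:
  assumes "pair_wf_digraph G" "pair_wf_digraph H"
  shows "graph_iso G H \<longleftrightarrow>
    (\<exists>f. bij_betw f (pverts G) (pverts H) \<and>
      (\<forall>u \<in> pverts G. \<forall>v \<in> pverts G. (u, v) \<in> parcs G \<longleftrightarrow> (f u, f v) \<in> parcs H))"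
    (is "?L \<longleftrightarrow> ?R")
proof
  interpret G: pair_wf_digraph G by fact
  assume ?L
  then obtain h where h: "pre_digraph.digraph_isomorphism (with_proj G) h"
    and H: "with_proj H = app_iso h (with_proj G)"
    by (auto simp: graph_iso_def digraph_iso_def)
  define f where "f = iso_verts h"
  have V: "pverts H = f ` pverts G" and A: "parcs H = iso_arcs h ` parcs G"
    and T: "iso_tail h = fst" and D: "iso_head h = snd"
    using H by (auto simp: app_iso_def with_proj_def f_def)
  have inj: "inj_on f (pverts G)"
    using h by (simp add: pre_digraph.digraph_isomorphism_def f_def)
  have arcs: "iso_arcs h (u, v) = (f u, f v)" if "(u, v) \<in> parcs G" for u v
    using h that
    by (fastforce simp: pre_digraph.digraph_isomorphism_def f_def T D prod_eq_iff)
  have "(u, v) \<in> parcs G \<longleftrightarrow> (f u, f v) \<in> parcs H" if "u \<in> pverts G" "v \<in> pverts G" for u v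
  proof
    assume "(u, v) \<in> parcs G"
    then show "(f u, f v) \<in> parcs H" unfolding A using arcs by (metis imageI)
  next
    assume "(f u, f v) \<in> parcs H"
    then obtain a b where ab: "(a, b) \<in> parcs G" "(f u, f v) = (f a, f b)"
      unfolding A using arcs by (metis imageE surj_pair)
    then have "u = a" "v = b"
      using inj that G.in_arcsD1[OF ab(1)] G.in_arcsD2[OF ab(1)] by (auto simp: inj_on_def)
    then show "(u, v) \<in> parcs G" using ab by simp
  qed
  then show ?R using inj V by (auto simp: bij_betw_def)
next
  interpret G: pair_wf_digraph G by fact
  interpret H: pair_wf_digraph H by fact
  assume ?R
  then obtain f where f: "bij_betw f (pverts G) (pverts H)"
    and e: "\<And>u v. u \<in> pverts G \<Longrightarrow> v \<in> pverts G \<Longrightarrow> (u, v) \<in> parcs G \<longleftrightarrow> (f u, f v) \<in> parcs H"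
    by auto
  define h where
    "h = \<lparr> iso_verts = f, iso_arcs = map_prod f f, iso_head = snd, iso_tail = fst \<rparr>"
  have inj: "inj_on f (pverts G)" and V: "f ` pverts G = pverts H"
    using f by (auto simp: bij_betw_def)
  have "parcs G \<subseteq> pverts G \<times> pverts G"
    using G.wellformed' by auto
  then have inj': "inj_on (map_prod f f) (parcs G)"
    using map_prod_inj_on[OF inj inj] inj_on_subset by blast
  have A: "map_prod f f ` parcs G = parcs H"
  proof (intro equalityI subsetI)
    fix x assume "x \<in> map_prod f f ` parcs G"
    then obtain u v where "x = (f u, f v)" and uv: "(u, v) \<in> parcs G" by auto
    then show "x \<in> parcs H" using e[OF G.in_arcsD1[OF uv] G.in_arcsD2[OF uv]] by simp
  next
    fix x assume x: "x \<in> parcs H"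
    obtain c d where cd: "x = (c, d)" by (cases x)
    have "c \<in> f ` pverts G" "d \<in> f ` pverts G"
      unfolding V using x H.in_arcsD1 H.in_arcsD2 unfolding cd by blast+
    then obtain a b where ab: "c = f a" "d = f b" "a \<in> pverts G" "b \<in> pverts G" by blast
    then have "(a, b) \<in> parcs G" using x e cd by simp
    then have "map_prod f f (a, b) \<in> map_prod f f ` parcs G" by (rule imageI)
    then show "x \<in> map_prod f f ` parcs G" by (simp add: cd ab)
  qed
  have "pre_digraph.digraph_isomorphism (with_proj G) h"
    using inj inj' G.wf_digraph
    by (auto simp: pre_digraph.digraph_isomorphism_def h_def)
  moreover have "with_proj H = app_iso h (with_proj G)"
    by (simp add: app_iso_def h_def A V with_proj_def)
  ultimately show ?L by (auto simp: graph_iso_def digraph_iso_def)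
qed

end

theory Submission
  imports Defs
begin

text \<open>
  Three connected spanning subgraphs of \<open>K\<^sub>n\<^sub>,\<^sub>n\<close> suffice to avoid every other \<open>F\<close>: a Hamiltonian path,
  a double star, and the spider with one leg of length 1 and \<open>n - 1\<close> legs of length 2. If \<open>F\<close>
  embeds into the path, its degrees are at most 2; if it also embeds into the double star, all its
  edges meet the preimages of the two centres, so \<open>F\<close> is one of the five graphs or \<open>2P\<^sub>3\<close>; and
  \<open>2P\<^sub>3\<close> does not embed into the spider, because every \<open>P\<^sub>3\<close> there uses the centre.
  Conversely, each of the five graphs is contained in \<open>P\<^sub>4\<close> or in \<open>P\<^sub>3 \<union> K\<^sub>2\<close>, and both of these
  occur in every connected spanning subgraph of \<open>K\<^sub>3\<^sub>,\<^sub>3\<close>.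
\<close>

section \<open>Embeddings\<close>

text \<open>Injective homomorphisms are the working form of \<open>contains_copy\<close>: they
  compose directly and need no intermediate subgraph. Only preservation of arcs is required, since
  copies need not be induced.\<close>

definition embeds :: "'a pair_pre_digraph \<Rightarrow> 'b pair_pre_digraph \<Rightarrow> bool" where
  "embeds F G \<longleftrightarrow> (\<exists>f. inj_on f (pverts F) \<and> f ` pverts F \<subseteq> pverts G \<and>
    (\<forall>u v. (u, v) \<in> parcs F \<longrightarrow> (f u, f v) \<in> parcs G))"

lemma embedsI:
  assumes "inj_on f (pverts F)" "\<And>v. v \<in> pverts F \<Longrightarrow> f v \<in> pverts G"
    "\<And>u v. (u, v) \<in> parcs F \<Longrightarrow> (f u, f v) \<in> parcs G"
  shows "embeds F G"
  using assms unfolding embeds_def by blast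

lemma embeds_trans:
  assumes "embeds F G" "embeds G H"
  shows "embeds F H"
proof -
  obtain f where f: "inj_on f (pverts F)" "f ` pverts F \<subseteq> pverts G"
      "\<And>u v. (u, v) \<in> parcs F \<Longrightarrow> (f u, f v) \<in> parcs G"
    using assms(1) unfolding embeds_def by blast
  obtain g where g: "inj_on g (pverts G)" "g ` pverts G \<subseteq> pverts H"
      "\<And>u v. (u, v) \<in> parcs G \<Longrightarrow> (g u, g v) \<in> parcs H"
    using assms(2) unfolding embeds_def by blast
  show ?thesis
  proof (rule embedsI[of "g \<circ> f"])
    show "inj_on (g \<circ> f) (pverts F)"
      using f(1,2) g(1) by (meson comp_inj_on inj_on_subset)
  qed (use f g in \<open>simp_all add: image_subset_iff\<close>)
qed

lemma pair_graphI:
  assumes "finite (pverts G)" "parcs G \<subseteq> pverts G \<times> pverts G" "sym (parcs G)" "irrefl (parcs G)"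
  shows "pair_graph G"
proof -
  have "finite (parcs G)"
    using assms(1,2) finite_subset by blast
  then show ?thesis
    by unfold_locales (use assms in \<open>auto simp: symmetric_def irrefl_def\<close>)
qed

lemma (in pair_graph) sym_parcs: "sym (parcs G)"
  using sym_arcs by (simp add: symmetric_def)

lemma subgraph_with_proj_iff:
  assumes "pair_wf_digraph H" "pair_wf_digraph G"
  shows "subgraph (with_proj H) (with_proj G) \<longleftrightarrow> pverts H \<subseteq> pverts G \<and> parcs H \<subseteq> parcs G"
  using assms by (simp add: subgraph_def wf_digraph_wp_iff compatible_def)

lemma graph_iso_imp_embeds:
  assumes "pair_graph F" "pair_graph G" "graph_iso F G"
  shows "embeds F G"
proof -
  interpret F: pair_graph F by fact
  interpret G: pair_graph G by fact
  obtain f where f: "bij_betw f (pverts F) (pverts G)"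
      "\<And>u v. u \<in> pverts F \<Longrightarrow> v \<in> pverts F \<Longrightarrow> (u, v) \<in> parcs F \<longleftrightarrow> (f u, f v) \<in> parcs G"
    using assms(3) graph_iso_iff_bij_betw[OF F.pair_wf_digraph_axioms G.pair_wf_digraph_axioms]
    by blast
  show ?thesis
  proof (rule embedsI[of f])
    fix u v assume "(u, v) \<in> parcs F"
    then show "(f u, f v) \<in> parcs G"
      using f(2) F.in_arcsD1 F.in_arcsD2 by metis
  qed (use f(1) in \<open>auto simp: bij_betw_def\<close>)
qed

text \<open>A copy \<open>H\<close> of \<open>F\<close> yields an embedding by inverting the
  isomorphism from \<open>H\<close> to \<open>F\<close>. Conversely, the copy is the image of
  \<open>F\<close> under the embedding, with only the images of arcs as arcs; the subgraph induced
  on the image vertices could have too many.\<close>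

lemma contains_copy_iff_embeds:
  assumes "pair_graph F" "pair_graph G"
  shows "contains_copy G F \<longleftrightarrow> embeds F G"
proof
  interpret F: pair_graph F by fact
  interpret G: pair_graph G by fact
  assume "contains_copy G F"
  then obtain H where H: "pair_graph H" "subgraph (with_proj H) (with_proj G)" "graph_iso H F"
    unfolding contains_copy_def by blast
  interpret H: pair_graph H by fact
  obtain f where f: "bij_betw f (pverts H) (pverts F)"
      "\<And>u v. u \<in> pverts H \<Longrightarrow> v \<in> pverts H \<Longrightarrow> (u, v) \<in> parcs H \<longleftrightarrow> (f u, f v) \<in> parcs F"
    using H(3) graph_iso_iff_bij_betw[OF H.pair_wf_digraph_axioms F.pair_wf_digraph_axioms] by blast
  let ?g = "inv_into (pverts H) f"
  have g: "bij_betw ?g (pverts F) (pverts H)"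
    using f(1) by (rule bij_betw_inv_into)
  have sub: "pverts H \<subseteq> pverts G" "parcs H \<subseteq> parcs G"
    using H(2) subgraph_with_proj_iff[OF H.pair_wf_digraph_axioms G.pair_wf_digraph_axioms] by auto
  show "embeds F G"
  proof (rule embedsI[of ?g])
    fix u v assume uv: "(u, v) \<in> parcs F"
    then have "u \<in> pverts F" "v \<in> pverts F"
      by (auto dest: F.in_arcsD1 F.in_arcsD2)
    then have "?g u \<in> pverts H" "?g v \<in> pverts H" "f (?g u) = u" "f (?g v) = v"
      using f(1) g bij_betw_inv_into_right[OF f(1)] by (auto simp: bij_betw_def)
    then show "(?g u, ?g v) \<in> parcs G"
      using f(2) uv sub(2) by auto
  qed (use g sub in \<open>auto simp: bij_betw_def\<close>)
next
  interpret F: pair_graph F by fact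
  interpret G: pair_graph G by fact
  assume "embeds F G"
  then obtain f where f: "inj_on f (pverts F)" "f ` pverts F \<subseteq> pverts G"
      "\<And>u v. (u, v) \<in> parcs F \<Longrightarrow> (f u, f v) \<in> parcs G"
    unfolding embeds_def by blast
  define H where "H = \<lparr>pverts = f ` pverts F, parcs = map_prod f f ` parcs F\<rparr>"
  have H: "pair_graph H"
  proof (rule pair_graphI)
    show "irrefl (parcs H)"
      using f(3) G.no_loops' by (fastforce simp: H_def irrefl_def)
    show "sym (parcs H)"
      using F.sym_parcs by (fastforce simp: H_def sym_def)
  qed (use F.wellformed' in \<open>auto simp: H_def\<close>)
  interpret H: pair_graph H by (rule H)
  have "graph_iso F H"
    unfolding graph_iso_iff_bij_betw[OF F.pair_wf_digraph_axioms H.pair_wf_digraph_axioms]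
  proof (intro exI[of _ f] conjI ballI)
    show "bij_betw f (pverts F) (pverts H)"
      using f(1) by (simp add: H_def bij_betw_def)
    fix u v assume uv: "u \<in> pverts F" "v \<in> pverts F"
    show "(u, v) \<in> parcs F \<longleftrightarrow> (f u, f v) \<in> parcs H"
    proof
      assume "(f u, f v) \<in> parcs H"
      then obtain x y where xy: "(x, y) \<in> parcs F" "f u = f x" "f v = f y"
        by (auto simp: H_def)
      then have "u = x" "v = y"
        using uv f(1) F.in_arcsD1[OF xy(1)] F.in_arcsD2[OF xy(1)] by (auto dest: inj_onD)
      with xy show "(u, v) \<in> parcs F" by simp
    qed (force simp: H_def)
  qed
  then have "graph_iso H F"
    unfolding graph_iso_def using F.wf_digraph by (auto intro: digraph_iso_swap)
  moreover have "subgraph (with_proj H) (with_proj G)"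
    unfolding subgraph_with_proj_iff[OF H.pair_wf_digraph_axioms G.pair_wf_digraph_axioms]
    using f by (auto simp: H_def)
  ultimately show "contains_copy G F"
    using H unfolding contains_copy_def by blast
qed

section \<open>Connected graphs\<close>

text \<open>The library notion uses walks in the symmetric closure that stay inside the vertex set.
  Both provisos vanish here, because the arc set is symmetric and every arc ends in a
  vertex.\<close>

lemma (in pair_graph) connected_iff_rtrancl:
  "Digraph_Component.connected (with_proj G) \<longleftrightarrow>
    pverts G \<noteq> {} \<and> (\<forall>u \<in> pverts G. \<forall>v \<in> pverts G. (u, v) \<in> (parcs G)\<^sup>*)"
proof -
  have "(u, v) \<in> rtrancl_on (pverts G) (parcs G) \<longleftrightarrow> (u, v) \<in> (parcs G)\<^sup>*"
    if "u \<in> pverts G" for u v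
  proof
    assume "(u, v) \<in> (parcs G)\<^sup>*"
    then show "(u, v) \<in> rtrancl_on (pverts G) (parcs G)"
      by induction (use that in \<open>auto intro: rtrancl_on_into_rtrancl_on dest: in_arcsD2\<close>)
  qed (rule rtrancl_on_rtranclI)
  moreover have "symcl (parcs G) = parcs G"
    using sym_parcs by (auto simp: symcl_def sym_def)
  ultimately show ?thesis
    by (simp add: connected_conv)
qed

lemma (in pair_graph) connectedI_root:
  assumes "r \<in> pverts G" "\<And>v. v \<in> pverts G \<Longrightarrow> (r, v) \<in> (parcs G)\<^sup>*"
  shows "Digraph_Component.connected (with_proj G)"
  unfolding connected_iff_rtrancl
  using assms sym_rtrancl[OF sym_parcs] by (metis empty_iff rtrancl_trans symE)

text \<open>Membership in \<open>S\<close> propagates along any walk from \<open>u\<close>. This is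
  how connectedness is exploited below: a small set closed under taking neighbours would have to be
  the whole graph.\<close>

lemma (in pair_graph) connected_closed_subset:
  assumes "Digraph_Component.connected (with_proj G)"
    and "u \<in> S" "u \<in> pverts G"
    and "\<And>x y. x \<in> S \<Longrightarrow> (x, y) \<in> parcs G \<Longrightarrow> y \<in> S"
  shows "pverts G \<subseteq> S"
proof
  fix v assume "v \<in> pverts G"
  then have "(u, v) \<in> (parcs G)\<^sup>*"
    using assms(1,3) connected_iff_rtrancl by blast
  then show "v \<in> S"
    by induction (use assms in blast)+
qed

section \<open>Spanning subgraphs of balanced complete bipartite graphs\<close>

text \<open>Both orientations of each edge are put in, so any relation \<open>R\<close> whatsoever
  gives a spanning subgraph of the complete bipartite graph, and a host graph is specified by
  \<open>R\<close> alone.\<close>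

definition bip_graph :: "nat \<Rightarrow> (nat \<Rightarrow> nat \<Rightarrow> bool) \<Rightarrow> (nat + nat) pair_pre_digraph" where
  "bip_graph n R = \<lparr> pverts = {..<n} <+> {..<n},
     parcs = {(Inl i, Inr j) |i j. i < n \<and> j < n \<and> R i j} \<union>
       {(Inr j, Inl i) |i j. i < n \<and> j < n \<and> R i j} \<rparr>"

lemma pverts_bip_graph [simp]:
  "pverts (bip_graph n R) = {..<n} <+> {..<n}"
  by (simp add: bip_graph_def)

lemma parcs_bip_graph [simp]:
  "(Inl i, Inr j) \<in> parcs (bip_graph n R) \<longleftrightarrow> i < n \<and> j < n \<and> R i j"
  "(Inr j, Inl i) \<in> parcs (bip_graph n R) \<longleftrightarrow> i < n \<and> j < n \<and> R i j"
  "(Inl i, Inl i') \<notin> parcs (bip_graph n R)"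
  "(Inr j, Inr j') \<notin> parcs (bip_graph n R)"
  by (auto simp: bip_graph_def)

lemma pair_graph_bip_graph: "pair_graph (bip_graph n R)"
  by (rule pair_graphI) (auto simp: bip_graph_def sym_def irrefl_def)

lemma pair_graph_complete_bipartite_graph: "pair_graph (complete_bipartite_graph m n)"
  by (rule pair_graphI) (auto simp: complete_bipartite_graph_def sym_def irrefl_def)

lemma spanning_subgraph_iff:
  "spanning_subgraph G (complete_bipartite_graph n n) \<longleftrightarrow>
    pair_graph G \<and> pverts G = {..<n} <+> {..<n} \<and> parcs G \<subseteq> parcs (complete_bipartite_graph n n)"
proof (cases "pair_graph G")
  case True
  interpret G: pair_graph G by fact
  interpret K: pair_graph "complete_bipartite_graph n n"
    by (rule pair_graph_complete_bipartite_graph)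
  have "pverts (complete_bipartite_graph n n) = {..<n} <+> {..<n}"
    by (simp add: complete_bipartite_graph_def)
  then show ?thesis
    using True subgraph_with_proj_iff[OF G.pair_wf_digraph_axioms K.pair_wf_digraph_axioms]
    by (auto simp: spanning_subgraph_def spanning_def)
qed (simp add: spanning_subgraph_def)

lemma spanning_subgraph_bip_graph:
  "spanning_subgraph (bip_graph n R) (complete_bipartite_graph n n)"
  unfolding spanning_subgraph_iff
  by (auto simp: pair_graph_bip_graph) (auto simp: bip_graph_def complete_bipartite_graph_def)

text \<open>The Hamiltonian path \<open>Inl 0\<close>, \<open>Inr 0\<close>, \<open>Inl 1\<close>,
  \<open>Inr 1\<close>, and so on, ending in \<open>Inr (n - 1)\<close>.\<close>

definition path_rel :: "nat \<Rightarrow> nat \<Rightarrow> bool" where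
  "path_rel i j \<longleftrightarrow> i = j \<or> i = Suc j"

text \<open>The two centres are \<open>Inl 0\<close> and \<open>Inr 0\<close>, which are adjacent;
  every other vertex is a leaf at the centre on the opposite side.\<close>

definition double_star_rel :: "nat \<Rightarrow> nat \<Rightarrow> bool" where
  "double_star_rel i j \<longleftrightarrow> i = 0 \<or> j = 0"

text \<open>The centre is \<open>Inl 0\<close>. The leg of length 1 is \<open>Inr 0\<close>, and for
  \<open>j > 0\<close> the leg of length 2 runs through \<open>Inr j\<close> to
  \<open>Inl j\<close>.\<close>

definition spider_rel :: "nat \<Rightarrow> nat \<Rightarrow> bool" where
  "spider_rel i j \<longleftrightarrow> i = 0 \<or> i = j"

text \<open>A walk to a right vertex is a walk to one of its left neighbours followed by one more
  arc, so only the left side needs explicit walks.\<close>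

lemma connected_bip_graphI:
  assumes "n \<ge> 1" "\<And>i. i < n \<Longrightarrow> (Inl 0, Inl i) \<in> (parcs (bip_graph n R))\<^sup>*"
    and "\<And>j. j < n \<Longrightarrow> \<exists>i<n. R i j"
  shows "Digraph_Component.connected (with_proj (bip_graph n R))"
proof -
  interpret pair_graph "bip_graph n R" by (rule pair_graph_bip_graph)
  show ?thesis
  proof (rule connectedI_root)
    show "Inl 0 \<in> pverts (bip_graph n R)" using assms(1) by auto
    fix v assume "v \<in> pverts (bip_graph n R)"
    then consider i where "i < n" "v = Inl i" | j where "j < n" "v = Inr j"
      by auto
    then show "(Inl 0, v) \<in> (parcs (bip_graph n R))\<^sup>*"
    proof cases
      case 2
      then obtain i where "i < n" "R i j" using assms(3) by blast
      then show ?thesis using 2 assms(2)[of i] by (auto intro: rtrancl_into_rtrancl)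
    qed (use assms(2) in auto)
  qed
qed

lemma connected_path:
  assumes "n \<ge> 1"
  shows "Digraph_Component.connected (with_proj (bip_graph n path_rel))"
proof (rule connected_bip_graphI[OF assms])
  fix i assume "i < n"
  then show "(Inl 0, Inl i) \<in> (parcs (bip_graph n path_rel))\<^sup>*"
  proof (induction i)
    case (Suc i)
    then have "(Inl 0, Inl i) \<in> (parcs (bip_graph n path_rel))\<^sup>*"
      by simp
    moreover have "(Inl i, Inr i) \<in> parcs (bip_graph n path_rel)"
      "(Inr i, Inl (Suc i)) \<in> parcs (bip_graph n path_rel)"
      using Suc.prems by (simp_all add: path_rel_def)
    ultimately show ?case by (meson rtrancl.rtrancl_into_rtrancl)
  qed simp
qed (auto simp: path_rel_def)

lemma connected_double_star:
  assumes "n \<ge> 1"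
  shows "Digraph_Component.connected (with_proj (bip_graph n double_star_rel))"
proof (rule connected_bip_graphI[OF assms])
  fix i assume "i < n"
  then have "(Inl 0, Inr 0) \<in> parcs (bip_graph n double_star_rel)"
    "(Inr 0, Inl i) \<in> parcs (bip_graph n double_star_rel)"
    by (simp_all add: double_star_rel_def)
  then show "(Inl 0, Inl i) \<in> (parcs (bip_graph n double_star_rel))\<^sup>*"
    by (meson r_into_rtrancl rtrancl_into_rtrancl)
next
  fix j show "\<exists>i<n. double_star_rel i j"
    using assms by (intro exI[of _ 0]) (simp add: double_star_rel_def)
qed

lemma connected_spider:
  assumes "n \<ge> 1"
  shows "Digraph_Component.connected (with_proj (bip_graph n spider_rel))"
proof (rule connected_bip_graphI[OF assms])
  fix i assume "i < n"
  then have "(Inl 0, Inr i) \<in> parcs (bip_graph n spider_rel)"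
    "(Inr i, Inl i) \<in> parcs (bip_graph n spider_rel)"
    by (simp_all add: spider_rel_def)
  then show "(Inl 0, Inl i) \<in> (parcs (bip_graph n spider_rel))\<^sup>*"
    by (meson r_into_rtrancl rtrancl_into_rtrancl)
qed (use assms in \<open>auto simp: spider_rel_def\<close>)

section \<open>Small linear forests\<close>

lemma complete_graph_2_eq_path: "complete_graph 2 = path_graph 2"
  by (auto simp: complete_graph_def path_graph_def)

lemma path_graph_simps:
  "pverts (path_graph 2) = {0, 1}"
  "parcs (path_graph 2) = {(0, 1), (1, 0)}"
  "pverts (path_graph 3) = {0, 1, 2}"
  "parcs (path_graph 3) = {(0, 1), (1, 0), (1, 2), (2, 1)}"
  "pverts (path_graph 4) = {0, 1, 2, 3}"
  "parcs (path_graph 4) = {(0, 1), (1, 0), (1, 2), (2, 1), (2, 3), (3, 2)}"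
  by (auto simp: path_graph_def)

lemma disjoint_union_simps:
  "pverts (disjoint_union G H) = Inl ` pverts G \<union> Inr ` pverts H"
  "parcs (disjoint_union G H) = map_prod Inl Inl ` parcs G \<union> map_prod Inr Inr ` parcs H"
  by (auto simp: disjoint_union_def)

text \<open>The map runs from the concrete graph \<open>X\<close> to \<open>F\<close>, so that it
  can later be given by list indexing: \<open>(!) [a, b, c]\<close> sends the path vertices 0, 1, 2
  to \<open>a\<close>, \<open>b\<close>, \<open>c\<close>. Injectivity turns the equality of arc
  images into reflection of arcs, and the isomorphism is reversed at the end.\<close>

lemma graph_isoI:
  assumes "pair_graph F" "pair_graph X"
    and "inj_on f (pverts X)" "f ` pverts X = pverts F" "map_prod f f ` parcs X = parcs F"
  shows "graph_iso F X"
proof -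
  interpret F: pair_graph F by fact
  interpret X: pair_graph X by fact
  have "graph_iso X F"
    unfolding graph_iso_iff_bij_betw[OF X.pair_wf_digraph_axioms F.pair_wf_digraph_axioms]
  proof (intro exI[of _ f] conjI ballI)
    show "bij_betw f (pverts X) (pverts F)"
      using assms(3,4) by (simp add: bij_betw_def)
    fix u v assume uv: "u \<in> pverts X" "v \<in> pverts X"
    show "(u, v) \<in> parcs X \<longleftrightarrow> (f u, f v) \<in> parcs F"
    proof
      assume "(f u, f v) \<in> parcs F"
      then obtain x y where xy: "(x, y) \<in> parcs X" "f u = f x" "f v = f y"
        unfolding assms(5)[symmetric] by auto
      then have "u = x" "v = y"
        using uv assms(3) X.in_arcsD1[OF xy(1)] X.in_arcsD2[OF xy(1)] by (auto dest: inj_onD)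
      with xy show "(u, v) \<in> parcs X" by simp
    qed (use assms(5) in force)
  qed
  then show ?thesis
    unfolding graph_iso_def using X.wf_digraph by (auto intro: digraph_iso_swap)
qed

lemma graph_iso_path_2I:
  assumes "pair_graph F" "distinct [a, b]" "pverts F = {a, b}" "parcs F = {(a, b), (b, a)}"
  shows "graph_iso F (path_graph 2)"
  by (rule graph_isoI[of _ _ "(!) [a, b]"])
    (use assms in \<open>simp_all add: pair_graph_path_graph path_graph_simps\<close>)

lemma graph_iso_path_3I:
  assumes "pair_graph F" "distinct [a, b, c]" "pverts F = {a, b, c}"
    and "parcs F = {(a, b), (b, a), (b, c), (c, b)}"
  shows "graph_iso F (path_graph 3)"
  by (rule graph_isoI[of _ _ "(!) [a, b, c]"])
    (use assms in \<open>simp_all add: pair_graph_path_graph path_graph_simps\<close>)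

lemma graph_iso_path_4I:
  assumes "pair_graph F" "distinct [a, b, c, d]" "pverts F = {a, b, c, d}"
    and "parcs F = {(a, b), (b, a), (b, c), (c, b), (c, d), (d, c)}"
  shows "graph_iso F (path_graph 4)"
  by (rule graph_isoI[of _ _ "(!) [a, b, c, d]"])
    (use assms in \<open>simp_all add: pair_graph_path_graph path_graph_simps\<close>)

lemma graph_iso_2_path_2I:
  assumes "pair_graph F" "distinct [a, b, c, d]" "pverts F = {a, b, c, d}"
    and "parcs F = {(a, b), (b, a), (c, d), (d, c)}"
  shows "graph_iso F (disjoint_union (path_graph 2) (path_graph 2))"
  by (rule graph_isoI[of _ _ "case_sum ((!) [a, b]) ((!) [c, d])"])
    (use assms in \<open>auto simp: pair_graph_path_graph pair_graph_disjoint_union path_graph_simps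
      disjoint_union_simps\<close>)

lemma graph_iso_path_3_path_2I:
  assumes "pair_graph F" "distinct [a, b, c, d, e]" "pverts F = {a, b, c, d, e}"
    and "parcs F = {(a, b), (b, a), (b, c), (c, b), (d, e), (e, d)}"
  shows "graph_iso F (disjoint_union (path_graph 3) (path_graph 2))"
  by (rule graph_isoI[of _ _ "case_sum ((!) [a, b, c]) ((!) [d, e])"])
    (use assms in \<open>auto simp: pair_graph_path_graph pair_graph_disjoint_union path_graph_simps
      disjoint_union_simps\<close>)

lemma (in pair_graph) embeds_path_4I:
  assumes "distinct [a, b, c, d]" "(a, b) \<in> parcs G" "(b, c) \<in> parcs G" "(c, d) \<in> parcs G"
  shows "embeds (path_graph 4) G"
  by (rule embedsI[of "(!) [a, b, c, d]"])
    (use assms in \<open>auto simp: path_graph_simps intro: arcs_symmetric dest: in_arcsD1 in_arcsD2\<close>)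

lemma (in pair_graph) embeds_path_3_path_2I:
  assumes "distinct [a, b, c, d, e]" "(a, b) \<in> parcs G" "(b, c) \<in> parcs G" "(d, e) \<in> parcs G"
  shows "embeds (disjoint_union (path_graph 3) (path_graph 2)) G"
  by (rule embedsI[of "case_sum ((!) [a, b, c]) ((!) [d, e])"])
    (use assms in \<open>auto simp: path_graph_simps disjoint_union_simps
      intro: arcs_symmetric dest: in_arcsD1 in_arcsD2\<close>)

lemma embeds_path_graph_mono: "m \<le> n \<Longrightarrow> embeds (path_graph m) (path_graph n)"
  by (rule embedsI[of id]) (auto simp: path_graph_def)

lemma embeds_2_path_2:
  "embeds (disjoint_union (path_graph 2) (path_graph 2)) (disjoint_union (path_graph 3) (path_graph 2))"
  by (rule embedsI[of id]) (auto simp: path_graph_simps disjoint_union_simps)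

section \<open>Unavoidable forests\<close>

text \<open>Each side has at least three vertices and at most two are excluded. The bound
  \<open>n \<ge> 3\<close> enters the unavoidability argument only here; \<open>b\<close> selects
  the side.\<close>

lemma ex_third_vertex:
  assumes "n \<ge> 3"
  obtains z where "z \<in> {..<n} <+> {..<n}" "isl z = b" "z \<noteq> x" "z \<noteq> (y :: nat + nat)"
proof -
  define c where "c = (if b then Inl else Inr :: nat \<Rightarrow> nat + nat)"
  have "distinct [c 0, c 1, c 2]" "\<And>k. isl (c k) = b" by (simp_all add: c_def)
  moreover from this(1) have "\<exists>k<3. c k \<noteq> x \<and> c k \<noteq> y"
    by (auto simp: eval_nat_numeral Ex_less_Suc2)
  moreover have "c k \<in> {..<n} <+> {..<n}" if "k < 3" for k
    using that assms by (auto simp: c_def)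
  ultimately show thesis using that by blast
qed

text \<open>The host graphs in which the forests are unavoidable. With \<open>n = 2\<close> there
  would be only four vertices, too few for P_3 \<union> K_2.\<close>

locale connected_balanced =
  pair_graph G for G :: "(nat + nat) pair_pre_digraph" +
  fixes n
  assumes connected: "Digraph_Component.connected (with_proj G)"
    and spanning: "spanning_subgraph G (complete_bipartite_graph n n)"
    and large: "n \<ge> 3"
begin

lemma verts: "pverts G = {..<n} <+> {..<n}"
  using spanning spanning_subgraph_iff by blast

lemma sides: "(x, y) \<in> parcs G \<Longrightarrow> isl x \<longleftrightarrow> \<not> isl y"
  using spanning spanning_subgraph_iff by (fastforce simp: complete_bipartite_graph_def)

lemma third_vertex: obtains z where "z \<in> pverts G" "isl z = b" "z \<noteq> x" "z \<noteq> y"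
  using ex_third_vertex[OF large] verts by metis

text \<open>An isolated vertex would be closed under taking neighbours, hence the only vertex of the
  connected graph.\<close>

lemma ex_neighbour:
  assumes "v \<in> pverts G"
  obtains w where "(v, w) \<in> parcs G"
proof (rule ccontr)
  assume "\<not> thesis"
  then have "pverts G \<subseteq> {v}"
    using connected_closed_subset[OF connected, of v "{v}"] assms that by blast
  then show False using third_vertex by blast
qed

text \<open>Without a \<open>P\<^sub>4\<close>, the neighbour of a leaf would dominate the whole graph, so \<open>G\<close> would be a
  star and one of its two sides a singleton.\<close>

lemma path_4_at_leaf:
  assumes "(u, v) \<in> parcs G" "\<And>w. (u, w) \<in> parcs G \<Longrightarrow> w = v"
  shows "\<exists>a b c d. (a, b) \<in> parcs G \<and> (b, c) \<in> parcs G \<and> (c, d) \<in> parcs G \<and> a \<noteq> c \<and> b \<noteq> d"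
proof (rule ccontr)
  assume "\<not> ?thesis"
  then have *: "a = c \<or> b = d"
    if "(a, b) \<in> parcs G" "(b, c) \<in> parcs G" "(c, d) \<in> parcs G" for a b c d
    using that by blast
  let ?S = "insert v {x. (v, x) \<in> parcs G}"
  have "pverts G \<subseteq> ?S"
  proof (rule connected_closed_subset[OF connected])
    show "v \<in> pverts G" using assms(1) by (rule in_arcsD2)
    fix x y assume "x \<in> ?S" "(x, y) \<in> parcs G"
    \<comment> \<open>For \<open>x = v\<close> this is the definition of the set. Otherwise the walk
      \<open>y\<close>, \<open>x\<close>, \<open>v\<close>, \<open>u\<close> is not a P_4, so
      \<open>y = v\<close> or \<open>x = u\<close>; in the latter case \<open>y = v\<close> again,
      because \<open>u\<close> is a leaf.\<close>
    then show "y \<in> ?S"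
      using *[of y x v u] assms arcs_symmetric by blast
  qed simp
  moreover obtain z where "z \<in> pverts G" "isl z = isl v" "z \<noteq> v"
    by (rule third_vertex)
  ultimately show False using sides by blast
qed

text \<open>Start from any edge \<open>bc\<close>. If one of its ends is a leaf, the previous lemma
  applies; otherwise the edge extends at both ends.\<close>

lemma ex_path_4:
  obtains a b c d where "(a, b) \<in> parcs G" "(b, c) \<in> parcs G" "(c, d) \<in> parcs G" "a \<noteq> c" "b \<noteq> d"
proof -
  obtain b where "b \<in> pverts G" by (rule third_vertex)
  then obtain c where bc: "(b, c) \<in> parcs G" by (rule ex_neighbour)
  show thesis
  proof (cases "(\<forall>a. (b, a) \<in> parcs G \<longrightarrow> a = c) \<or> (\<forall>d. (c, d) \<in> parcs G \<longrightarrow> d = b)")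
    case True
    then have "\<exists>a b c d. (a, b) \<in> parcs G \<and> (b, c) \<in> parcs G \<and> (c, d) \<in> parcs G \<and> a \<noteq> c \<and> b \<noteq> d"
      using path_4_at_leaf[OF bc] path_4_at_leaf[OF arcs_symmetric[OF bc]] by blast
    then show thesis using that by blast
  next
    case False
    then obtain a d where "(b, a) \<in> parcs G" "a \<noteq> c" "(c, d) \<in> parcs G" "d \<noteq> b" by blast
    then show thesis using that[of a b c d] bc arcs_symmetric by blast
  qed
qed

lemma embeds_path_4: "embeds (path_graph 4) G"
proof -
  obtain a b c d where "(a, b) \<in> parcs G" "(b, c) \<in> parcs G" "(c, d) \<in> parcs G" "a \<noteq> c" "b \<noteq> d"
    by (rule ex_path_4)
  \<comment> \<open>Bipartiteness supplies the missing inequalities: vertices at odd distance along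
    the path, including \<open>a\<close> and \<open>d\<close>, lie on opposite sides.\<close>
  then show ?thesis
    by (intro embeds_path_4I[of a b c d]) (auto dest: sides)
qed

text \<open>The path \<open>a b c d\<close> uses only \<open>b\<close> and \<open>d\<close> on their
  side, so a third vertex \<open>w\<close> there lies off the path. Its neighbour \<open>x\<close>
  is \<open>a\<close>, \<open>c\<close> or a new vertex, and in each case the path together with the
  edge \<open>wx\<close> contains P_3 \<union> K_2.\<close>

lemma embeds_path_3_path_2: "embeds (disjoint_union (path_graph 3) (path_graph 2)) G"
proof -
  obtain a b c d where p: "(a, b) \<in> parcs G" "(b, c) \<in> parcs G" "(c, d) \<in> parcs G" "a \<noteq> c" "b \<noteq> d"
    by (rule ex_path_4)
  note q = p(1-3)[THEN arcs_symmetric]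
  obtain w where w: "w \<in> pverts G" "isl w = isl b" "w \<noteq> b" "w \<noteq> d"
    by (rule third_vertex)
  obtain x where x: "(w, x) \<in> parcs G"
    using w(1) by (rule ex_neighbour)
  consider "x = a" | "x = c" | "x \<noteq> a" "x \<noteq> c" by blast
  then show ?thesis
  proof cases
    case 1
    then show ?thesis
      using p q x w by (intro embeds_path_3_path_2I[of w a b c d]) (auto dest: sides)
  next
    case 2
    then show ?thesis
      using p q x w by (intro embeds_path_3_path_2I[of w c d a b]) (auto dest: sides)
  next
    case 3
    then show ?thesis
      using p q x w by (intro embeds_path_3_path_2I[of a b c w x]) (auto dest: sides)
  qed
qed

end

section \<open>Graphs embedding into the path, the double star and the spider\<close>

text \<open>The neighbours of \<open>v\<close> are mapped injectively to neighbours of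
  \<open>f v\<close>, of which the path offers at most two.\<close>

lemma degree_le_2_if_embeds_path:
  assumes "pair_graph F" "embeds F (bip_graph n path_rel)"
  shows "card {w. (v, w) \<in> parcs F} \<le> 2"
proof -
  interpret F: pair_graph F by fact
  obtain f where f: "inj_on f (pverts F)"
      "\<And>u v. (u, v) \<in> parcs F \<Longrightarrow> (f u, f v) \<in> parcs (bip_graph n path_rel)"
    using assms(2) unfolding embeds_def by blast
  let ?N = "{w. (v, w) \<in> parcs F}"
  obtain x y where xy: "f ` ?N \<subseteq> {x, y}"
  proof (cases "f v")
    case (Inl i)
    \<comment> \<open>For \<open>i = 0\<close> the subtraction truncates and the two candidates
      coincide, as they should at an end of the path.\<close>
    then have "f w \<in> {Inr i, Inr (i - 1)}" if "(v, w) \<in> parcs F" for w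
      using f(2)[OF that] by (cases "f w") (auto simp: path_rel_def)
    then show thesis using that by blast
  next
    case (Inr j)
    then have "f w \<in> {Inl j, Inl (Suc j)}" if "(v, w) \<in> parcs F" for w
      using f(2)[OF that] by (cases "f w") (auto simp: path_rel_def)
    then show thesis using that by blast
  qed
  have "inj_on f ?N"
    using f(1) by (rule inj_on_subset) (auto dest: F.in_arcsD2)
  then have "card ?N = card (f ` ?N)" by (simp add: card_image)
  also have "\<dots> \<le> card {x, y}" using xy by (intro card_mono) auto
  also have "\<dots> \<le> 2" by (simp add: card_insert_if)
  finally show ?thesis .
qed

text \<open>Deleting the centre \<open>Inl 0\<close> from the spider leaves a matching and the
  isolated vertex \<open>Inr 0\<close>, so every P_3 contains the centre. Two disjoint copies would
  map two different vertices to it.\<close>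

lemma spider_no_2_path_3:
  assumes "embeds F (bip_graph n spider_rel)" "pair_graph F"
    and "(a, x) \<in> parcs F" "(a, y) \<in> parcs F" "x \<noteq> y"
    and "(b, z) \<in> parcs F" "(b, w) \<in> parcs F" "z \<noteq> w"
    and "{a, x, y} \<inter> {b, z, w} = {}"
  shows False
proof -
  interpret F: pair_graph F by fact
  obtain f where f: "inj_on f (pverts F)"
      "\<And>u v. (u, v) \<in> parcs F \<Longrightarrow> (f u, f v) \<in> parcs (bip_graph n spider_rel)"
    using assms(1) unfolding embeds_def by blast
  have "Inl 0 \<in> f ` {a, x, y}" if "(a, x) \<in> parcs F" "(a, y) \<in> parcs F" "x \<noteq> y" for a x y
  proof -
    have "f x \<noteq> f y"
      using that f(1) F.in_arcsD2 by (metis inj_onD)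
    then show ?thesis
      using f(2)[OF that(1)] f(2)[OF that(2)]
      by (cases "f a"; cases "f x"; cases "f y") (auto simp: spider_rel_def)
  qed
  then have "Inl 0 \<in> f ` {a, x, y}" "Inl 0 \<in> f ` {b, z, w}"
    using assms by blast+
  then obtain u v where "u \<in> {a, x, y}" "v \<in> {b, z, w}" "f u = f v"
    by (metis imageE)
  moreover have "u \<in> pverts F" "v \<in> pverts F"
    using calculation assms by (auto dest: F.in_arcsD1 F.in_arcsD2)
  ultimately show False
    using f(1) assms(9) by (metis disjoint_iff inj_onD)
qed

section \<open>Isomorphism types of stars and pairs of stars with few leaves\<close>

lemma card_le_1_cases:
  assumes "finite A" "card A \<le> 1"
  obtains "A = {}" | x where "A = {x}"
  using assms by (metis One_nat_def card_0_eq card_1_singletonE le_0_eq le_Suc_eq)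

lemma card_le_2_cases:
  assumes "finite A" "card A \<le> 2" "A \<noteq> {}"
  obtains x where "A = {x}" | x y where "A = {x, y}" "x \<noteq> y"
proof (cases "card A = 2")
  case True
  then show thesis using that by (auto simp: card_2_iff)
next
  case False
  then show thesis using assms that by (auto elim!: card_le_1_cases[of A])
qed

text \<open>Serves the case in which only one centre of the double star has a preimage
  \<open>a\<close>; \<open>A\<close> collects the leaves at \<open>a\<close>.\<close>

lemma star_cases:
  assumes F: "pair_graph F" and V: "pverts F = insert a A"
    and E: "parcs F = {a} \<times> A \<union> A \<times> {a}"
    and A: "a \<notin> A" "A \<noteq> {}" "card A \<le> 2"
  shows "graph_iso F (path_graph 2) \<or> graph_iso F (path_graph 3)"
proof -
  interpret pair_graph F by fact
  have "finite A" using V pair_finite_verts by (metis finite_insert)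
  then show ?thesis
    using A(3,2)
  proof (cases rule: card_le_2_cases)
    case (1 x)
    then have "graph_iso F (path_graph 2)"
      using V E A(1) by (intro graph_iso_path_2I[OF F, of a x]) auto
    then show ?thesis ..
  next
    case (2 x y)
    then have "graph_iso F (path_graph 3)"
      using V E A(1) by (intro graph_iso_path_3I[OF F, of x a y]) auto
    then show ?thesis ..
  qed
qed

text \<open>Serves the case of adjacent preimages \<open>a\<close> and \<open>b\<close> of the two
  centres. The edge \<open>ab\<close> is prolonged by at most one leaf at each end, which gives a
  path on two, three or four vertices.\<close>

lemma double_star_cases:
  assumes F: "pair_graph F" and V: "pverts F = {a, b} \<union> A \<union> B"
    and E: "parcs F = {a} \<times> A \<union> A \<times> {a} \<union> {b} \<times> B \<union> B \<times> {b} \<union> {(a, b), (b, a)}"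
    and D: "a \<noteq> b" "{a, b} \<inter> (A \<union> B) = {}" "A \<inter> B = {}" "card A \<le> 1" "card B \<le> 1"
  shows "graph_iso F (path_graph 2) \<or> graph_iso F (path_graph 3) \<or> graph_iso F (path_graph 4)"
proof -
  interpret pair_graph F by fact
  have fin: "finite A" "finite B" using V pair_finite_verts by (metis finite_Un)+
  show ?thesis
    using fin(1) D(4)
  proof (cases rule: card_le_1_cases)
    case A: 1
    show ?thesis using fin(2) D(5)
    proof (cases rule: card_le_1_cases)
      case 1
      with A have "graph_iso F (path_graph 2)"
        using V E D by (intro graph_iso_path_2I[OF F, of a b]) auto
      then show ?thesis by blast
    next
      case (2 y)
      with A have "graph_iso F (path_graph 3)"
        using V E D by (intro graph_iso_path_3I[OF F, of a b y]) auto
      then show ?thesis by blast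
    qed
  next
    case A: (2 x)
    show ?thesis using fin(2) D(5)
    proof (cases rule: card_le_1_cases)
      case 1
      with A have "graph_iso F (path_graph 3)"
        using V E D by (intro graph_iso_path_3I[OF F, of x a b]) auto
      then show ?thesis by blast
    next
      case (2 y)
      with A have "graph_iso F (path_graph 4)"
        using V E D by (intro graph_iso_path_4I[OF F, of x a b y]) auto
      then show ?thesis by blast
    qed
  qed
qed

text \<open>Serves the case of non-adjacent preimages of the centres: \<open>F\<close> is a disjoint
  union of two stars with one or two leaves each. Two leaves at both would make 2P_3, and the spider
  is needed exactly to exclude this.\<close>

lemma two_stars_cases:
  assumes F: "pair_graph F" and V: "pverts F = {a, b} \<union> A \<union> B"
    and E: "parcs F = {a} \<times> A \<union> A \<times> {a} \<union> {b} \<times> B \<union> B \<times> {b}"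
    and D: "a \<noteq> b" "{a, b} \<inter> (A \<union> B) = {}" "A \<inter> B = {}"
    and A: "A \<noteq> {}" "card A \<le> 2" and B: "B \<noteq> {}" "card B \<le> 2"
    and spider: "embeds F (bip_graph n spider_rel)"
  shows "graph_iso F (disjoint_union (path_graph 2) (path_graph 2)) \<or>
    graph_iso F (disjoint_union (path_graph 3) (path_graph 2))"
proof -
  interpret pair_graph F by fact
  have fin: "finite A" "finite B" using V pair_finite_verts by (metis finite_Un)+
  show ?thesis
    using fin(1) A(2,1)
  proof (cases rule: card_le_2_cases)
    case A: (1 x)
    show ?thesis using fin(2) B(2,1)
    proof (cases rule: card_le_2_cases)
      case (1 z)
      with A have "graph_iso F (disjoint_union (path_graph 2) (path_graph 2))"
        using V E D by (intro graph_iso_2_path_2I[OF F, of a x b z]) auto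
      then show ?thesis by blast
    next
      case (2 z w)
      with A have "graph_iso F (disjoint_union (path_graph 3) (path_graph 2))"
        using V E D by (intro graph_iso_path_3_path_2I[OF F, of z b w a x]) auto
      then show ?thesis by blast
    qed
  next
    case A: (2 x y)
    show ?thesis using fin(2) B(2,1)
    proof (cases rule: card_le_2_cases)
      case (1 z)
      with A have "graph_iso F (disjoint_union (path_graph 3) (path_graph 2))"
        using V E D by (intro graph_iso_path_3_path_2I[OF F, of x a y b z]) auto
      then show ?thesis by blast
    next
      case (2 z w)
      have False
        by (rule spider_no_2_path_3[OF spider F, of a x y b z w]) (use A 2 E D in auto)
      then show ?thesis ..
    qed
  qed
qed

text \<open>The shape of \<open>F\<close> is read off from its embedding into the double star, by
  which of the two centres have preimages and whether these are adjacent. The path bounds the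
  numbers of leaves, and the spider settles the case of two separate stars.\<close>

lemma embeds_all_three_cases:
  assumes F: "pair_graph F" and ne: "parcs F \<noteq> {}" and ni: "no_isolated_verts F"
    and path: "embeds F (bip_graph n path_rel)"
    and dstar: "embeds F (bip_graph n double_star_rel)"
    and spider: "embeds F (bip_graph n spider_rel)"
  shows "graph_iso F (path_graph 2)
    \<or> graph_iso F (disjoint_union (path_graph 2) (path_graph 2))
    \<or> graph_iso F (path_graph 3)
    \<or> graph_iso F (disjoint_union (path_graph 3) (path_graph 2))
    \<or> graph_iso F (path_graph 4)"
proof -
  interpret pair_graph F by fact
  have deg: "card {w. (v, w) \<in> parcs F} \<le> 2" for v
    using F path by (rule degree_le_2_if_embeds_path)
  obtain f where inj: "inj_on f (pverts F)"
      and hom: "\<And>u v. (u, v) \<in> parcs F \<Longrightarrow> (f u, f v) \<in> parcs (bip_graph n double_star_rel)"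
    using dstar unfolding embeds_def by blast
  \<comment> \<open>The sides are crossed: \<open>Inr (Suc j)\<close> is a leaf at the centre
    \<open>Inl 0\<close>, so \<open>A\<close> holds the leaves at the preimage of
    \<open>Inl 0\<close>, and \<open>B\<close> those at the preimage of
    \<open>Inr 0\<close>.\<close>
  define A where "A = {v \<in> pverts F. \<exists>j. f v = Inr (Suc j)}"
  define B where "B = {v \<in> pverts F. \<exists>i. f v = Inl (Suc i)}"
  have AB: "A \<inter> B = {}" by (auto simp: A_def B_def)
  have vert: "v \<in> A \<or> v \<in> B \<or> f v = Inl 0 \<or> f v = Inr 0" if "v \<in> pverts F" for v
  proof (cases "f v")
    case (Inl i)
    with that show ?thesis by (cases i) (auto simp: B_def)
  next
    case (Inr j)
    with that show ?thesis by (cases j) (auto simp: A_def)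
  qed
  have arc: "(f u = Inl 0 \<and> (v \<in> A \<or> f v = Inr 0)) \<or> (f u = Inr 0 \<and> (v \<in> B \<or> f v = Inl 0))
      \<or> (u \<in> A \<and> f v = Inl 0) \<or> (u \<in> B \<and> f v = Inr 0)"
    if "(u, v) \<in> parcs F" for u v
    using hom[OF that] in_arcsD1[OF that, THEN vert] in_arcsD2[OF that, THEN vert]
    by (cases "f u"; cases "f v") (auto simp: double_star_rel_def A_def B_def)
  \<comment> \<open>Since \<open>x\<close> is not isolated and its image is a leaf of the double
    star, the centre next to that leaf must have a preimage adjacent to \<open>x\<close>.\<close>
  have A: "\<exists>a. f a = Inl 0 \<and> (x, a) \<in> parcs F \<and> (a, x) \<in> parcs F" if x: "x \<in> A" for x
  proof -
    obtain w where w: "(x, w) \<in> parcs F"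
      using x ni unfolding A_def no_isolated_verts_def by blast
    have "f w = Inl 0" using arc[OF w] x by (auto simp: A_def B_def)
    then show ?thesis using w arcs_symmetric by blast
  qed
  have B: "\<exists>b. f b = Inr 0 \<and> (x, b) \<in> parcs F \<and> (b, x) \<in> parcs F" if x: "x \<in> B" for x
  proof -
    obtain w where w: "(x, w) \<in> parcs F"
      using x ni unfolding B_def no_isolated_verts_def by blast
    have "f w = Inr 0" using arc[OF w] x by (auto simp: A_def B_def)
    then show ?thesis using w arcs_symmetric by blast
  qed
  have sub: "A \<subseteq> pverts F" "B \<subseteq> pverts F" by (auto simp: A_def B_def)
  have fin: "finite {w. (v, w) \<in> parcs F}" for v
    by (rule finite_subset[OF _ pair_finite_verts]) (auto dest: in_arcsD2)
  have ex: "(\<exists>a\<in>pverts F. f a = Inl 0) \<or> (\<exists>b\<in>pverts F. f b = Inr 0)"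
  proof -
    obtain u v where "(u, v) \<in> parcs F" using ne by auto
    then show ?thesis using arc in_arcsD1 in_arcsD2 by blast
  qed
  \<comment> \<open>By injectivity the neighbour provided by \<open>A\<close> is the given preimage
    \<open>a\<close>, so all of \<open>A\<close> is joined to \<open>a\<close>.\<close>
  have a_props: "(a, x) \<in> parcs F" "(x, a) \<in> parcs F"
    if "x \<in> A" "a \<in> pverts F" "f a = Inl 0" for a x
    using A[OF that(1)] that inj in_arcsD1 by (metis inj_onD)+
  have b_props: "(b, x) \<in> parcs F" "(x, b) \<in> parcs F"
    if "x \<in> B" "b \<in> pverts F" "f b = Inr 0" for b x
    using B[OF that(1)] that inj in_arcsD1 by (metis inj_onD)+
  show ?thesis
  proof (cases "\<exists>a\<in>pverts F. f a = Inl 0")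
    case True
    then obtain a where a: "a \<in> pverts F" "f a = Inl 0" by blast
    have a_unique: "v = a" if "v \<in> pverts F" "f v = Inl 0" for v
      using that a inj by (metis inj_onD)
    have aN: "a \<notin> A" "a \<notin> B" using a by (auto simp: A_def B_def)
    have cardA: "card A \<le> 2"
      using deg[of a] card_mono[OF fin[of a], of A] a_props[OF _ a] by force
    show ?thesis
    proof (cases "\<exists>b\<in>pverts F. f b = Inr 0")
      case True
      then obtain b where b: "b \<in> pverts F" "f b = Inr 0" by blast
      have b_unique: "v = b" if "v \<in> pverts F" "f v = Inr 0" for v
        using that b inj by (metis inj_onD)
      have bN: "b \<notin> A" "b \<notin> B" using b by (auto simp: A_def B_def)
      have cardB: "card B \<le> 2"
        using deg[of b] card_mono[OF fin[of b], of B] b_props[OF _ b] by force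
      have V: "pverts F = {a, b} \<union> A \<union> B"
        using vert a_unique b_unique a b sub by blast
      have "a \<noteq> b" using a b by auto
      have arc': "(u, v) \<in> {a} \<times> A \<union> A \<times> {a} \<union> {b} \<times> B \<union> B \<times> {b} \<union> {(a, b), (b, a)}"
        if "(u, v) \<in> parcs F" for u v
        using arc[OF that] a_unique b_unique in_arcsD1[OF that] in_arcsD2[OF that] by blast
      have sup: "{a} \<times> A \<union> A \<times> {a} \<union> {b} \<times> B \<union> B \<times> {b} \<subseteq> parcs F"
        using a_props[OF _ a] b_props[OF _ b] by blast
      show ?thesis
      proof (cases "(a, b) \<in> parcs F")
        case True
        then have "(b, a) \<in> parcs F" by (rule arcs_symmetric)
        \<comment> \<open>The vertex \<open>b\<close> already takes up one of the at most two
          neighbours of \<open>a\<close>, which leaves room for at most one leaf.\<close>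
        have "card (insert b A) \<le> card {w. (a, w) \<in> parcs F}"
          using fin True a_props[OF _ a] by (intro card_mono) auto
        with deg[of a] bN have 1: "card A \<le> 1"
          using finite_subset[OF sub(1) pair_finite_verts] by simp
        have "card (insert a B) \<le> card {w. (b, w) \<in> parcs F}"
          using fin \<open>(b, a) \<in> _\<close> b_props[OF _ b] by (intro card_mono) auto
        with deg[of b] aN have 2: "card B \<le> 1"
          using finite_subset[OF sub(2) pair_finite_verts] by simp
        have "parcs F = {a} \<times> A \<union> A \<times> {a} \<union> {b} \<times> B \<union> B \<times> {b} \<union> {(a, b), (b, a)}"
          using arc' sup True \<open>(b, a) \<in> _\<close> by (intro equalityI subrelI) blast+
        from double_star_cases[OF F V this \<open>a \<noteq> b\<close> _ AB 1 2] show ?thesis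
          using aN bN by blast
      next
        case False
        then have "(b, a) \<notin> parcs F" using arcs_symmetric by blast
        have E: "parcs F = {a} \<times> A \<union> A \<times> {a} \<union> {b} \<times> B \<union> B \<times> {b}"
          using arc' sup False \<open>(b, a) \<notin> _\<close> by (intro equalityI subrelI) blast+
        \<comment> \<open>Without the edge \<open>ab\<close>, a neighbour of \<open>a\<close> or
          \<open>b\<close> can only be a leaf, and neither vertex is isolated.\<close>
        obtain x y where "(a, x) \<in> parcs F" "(b, y) \<in> parcs F"
          using a b ni unfolding no_isolated_verts_def by blast
        then have "A \<noteq> {}" "B \<noteq> {}"
          unfolding E using aN bN \<open>a \<noteq> b\<close> by auto
        with two_stars_cases[OF F V E \<open>a \<noteq> b\<close> _ AB _ cardA _ cardB spider] show ?thesis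
          using aN bN by blast
      qed
    next
      case False
      \<comment> \<open>A vertex in \<open>B\<close> would have a neighbour mapped to
        \<open>Inr 0\<close>, which has no preimage in this case.\<close>
      then have "B = {}" using B in_arcsD2 by blast
      then have V: "pverts F = insert a A"
        using vert a_unique a sub False by blast
      have E: "parcs F = {a} \<times> A \<union> A \<times> {a}"
      proof (intro equalityI subrelI)
        fix u v assume uv: "(u, v) \<in> parcs F"
        show "(u, v) \<in> {a} \<times> A \<union> A \<times> {a}"
          using arc[OF uv] a_unique False \<open>B = {}\<close> in_arcsD1[OF uv] in_arcsD2[OF uv] by blast
      qed (use a_props[OF _ a] in blast)
      then have "A \<noteq> {}" using ne by auto
      from star_cases[OF F V E aN(1) this cardA] show ?thesis by blast
    qed
  next
    case False
    then obtain b where b: "b \<in> pverts F" "f b = Inr 0" using ex by blast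
    have b_unique: "v = b" if "v \<in> pverts F" "f v = Inr 0" for v
      using that b inj by (metis inj_onD)
    have bN: "b \<notin> B" using b by (auto simp: B_def)
    have cardB: "card B \<le> 2"
      using deg[of b] card_mono[OF fin[of b], of B] b_props[OF _ b] by force
    have "A = {}" using False A in_arcsD2 by blast
    then have V: "pverts F = insert b B"
      using vert b_unique b sub False by blast
    have E: "parcs F = {b} \<times> B \<union> B \<times> {b}"
    proof (intro equalityI subrelI)
      fix u v assume uv: "(u, v) \<in> parcs F"
      show "(u, v) \<in> {b} \<times> B \<union> B \<times> {b}"
        using arc[OF uv] b_unique False \<open>A = {}\<close> in_arcsD1[OF uv] in_arcsD2[OF uv] by blast
    qed (use b_props[OF _ b] in blast)
    then have "B \<noteq> {}" using ne by auto
    from star_cases[OF F V E bN this cardB] show ?thesis by blast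
  qed
qed

section \<open>The equivalence of avoidability with not being one of the five small forests\<close>

theorem proposition1:
  fixes F :: "'a pair_pre_digraph"
  assumes "pair_graph F"
    and "bipartite F"
    and "parcs F \<noteq> {}"
    and "no_isolated_verts F"
  shows "(\<forall>n\<ge>1. \<exists>G. spanning_subgraph G (complete_bipartite_graph n n)
            \<and> Digraph_Component.connected (with_proj G) \<and> \<not> contains_copy G F)
    \<longleftrightarrow> \<not> (graph_iso F (complete_graph 2)
          \<or> graph_iso F (disjoint_union (complete_graph 2) (complete_graph 2))
          \<or> graph_iso F (path_graph 3)
          \<or> graph_iso F (disjoint_union (path_graph 3) (complete_graph 2))
          \<or> graph_iso F (path_graph 4))"
proof -
  interpret F: pair_graph F by fact
  show ?thesis
    unfolding complete_graph_2_eq_path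
  proof (intro iffI notI)
    assume avoid: "\<forall>n\<ge>1. \<exists>G. spanning_subgraph G (complete_bipartite_graph n n)
      \<and> Digraph_Component.connected (with_proj G) \<and> \<not> contains_copy G F"
    assume small: "graph_iso F (path_graph 2)
      \<or> graph_iso F (disjoint_union (path_graph 2) (path_graph 2))
      \<or> graph_iso F (path_graph 3)
      \<or> graph_iso F (disjoint_union (path_graph 3) (path_graph 2))
      \<or> graph_iso F (path_graph 4)"
    \<comment> \<open>A single order refutes avoidability; 3 is the least \<open>n\<close> for which
      the host graph has room for P_3 \<union> K_2.\<close>
    obtain G where G: "spanning_subgraph G (complete_bipartite_graph 3 3)"
        "Digraph_Component.connected (with_proj G)" "\<not> contains_copy G F"
      using avoid[rule_format, of 3] by auto
    have "pair_graph G" using G(1) by (simp add: spanning_subgraph_def)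
    then interpret connected_balanced G 3
      using G by (intro connected_balanced.intro connected_balanced_axioms.intro) auto
    consider "embeds F (path_graph 2)"
      | "embeds F (disjoint_union (path_graph 2) (path_graph 2))"
      | "embeds F (path_graph 3)"
      | "embeds F (disjoint_union (path_graph 3) (path_graph 2))"
      | "embeds F (path_graph 4)"
      using small graph_iso_imp_embeds[OF assms(1) pair_graph_path_graph]
        graph_iso_imp_embeds[OF assms(1)
          pair_graph_disjoint_union[OF pair_graph_path_graph pair_graph_path_graph]]
      by blast
    \<comment> \<open>P_4 and P_3 \<union> K_2 are the maximal graphs of the list under embedding,
      so only these two have to be found in \<open>G\<close>.\<close>
    then have "embeds F (path_graph 4) \<or> embeds F (disjoint_union (path_graph 3) (path_graph 2))"
    proof cases
      case 1
      then show ?thesis using embeds_trans[OF 1 embeds_path_graph_mono[of 2 4]] by simp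
    next
      case 2
      then show ?thesis using embeds_trans[OF 2 embeds_2_path_2] by simp
    next
      case 3
      then show ?thesis using embeds_trans[OF 3 embeds_path_graph_mono[of 3 4]] by simp
    qed simp_all
    then have "embeds F G"
      by (elim disjE) (rule embeds_trans, assumption, rule embeds_path_4 embeds_path_3_path_2)+
    then show False
      using G(3) contains_copy_iff_embeds[OF assms(1) \<open>pair_graph G\<close>] by blast
  next
    assume large: "\<not> (graph_iso F (path_graph 2)
      \<or> graph_iso F (disjoint_union (path_graph 2) (path_graph 2))
      \<or> graph_iso F (path_graph 3)
      \<or> graph_iso F (disjoint_union (path_graph 3) (path_graph 2))
      \<or> graph_iso F (path_graph 4))"
    show "\<forall>n\<ge>1. \<exists>G. spanning_subgraph G (complete_bipartite_graph n n)
      \<and> Digraph_Component.connected (with_proj G) \<and> \<not> contains_copy G F"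
    proof (intro allI impI)
      fix n :: nat assume "n \<ge> 1"
      \<comment> \<open>If \<open>F\<close> embedded into all three host graphs of this order, it
        would be one of the five graphs. So at least one of them avoids \<open>F\<close>; which one
        may depend on \<open>n\<close>.\<close>
      obtain R where "Digraph_Component.connected (with_proj (bip_graph n R))"
        "\<not> embeds F (bip_graph n R)"
        using embeds_all_three_cases[OF assms(1,3,4)] large connected_path[OF \<open>n \<ge> 1\<close>]
          connected_double_star[OF \<open>n \<ge> 1\<close>] connected_spider[OF \<open>n \<ge> 1\<close>] by blast
      then show "\<exists>G. spanning_subgraph G (complete_bipartite_graph n n)
        \<and> Digraph_Component.connected (with_proj G) \<and> \<not> contains_copy G F"
        using spanning_subgraph_bip_graph contains_copy_iff_embeds[OF assms(1) pair_graph_bip_graph]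
        by blast
    qed
  qed
qed

end
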